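(* For all integers $k>r\ge 3$, asymptotically almost surely (i.e., with probability tending to $1$ as $n\to\infty$), $$t^{(r)}(W_k(n))\ge \Pi_{r,k}\cdot\frac{n}{k}-o(n),\qquad\text{where } \Pi_{r,k}=\prod_{j=r+1}^{k}\frac{j^r}{j^r-1}.$$
   Context: For a word $w=w_1\cdots w_n$ over a finite alphabet, $r$-twins of length $t$ are $r$ pairwise disjoint index sets $\{i^{(q)}_1<\cdots<i^{(q)}_t\}$, $q=1,\dots,r$, such that the subwords $w_{i^{(q)}_1}\cdots w_{i^{(q)}_t}$ are all identical. $t^{(r)}(w)$ is the maximum length of $r$-twins in $w$. $W_k(n)$ is a word chosen uniformly at random among all $k^n$ words of length $n$ over a $k$-letter alphabet. The statement means that there is a function $f(n)=o(n)$ such that $\Pr\big(t^{(r)}(W_k(n))\ge \Pi_{r,k}n/k-f(n)\big)\to 1$. *)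

theory Defs
  imports "HOL-Probability.Probability" "HOL-Library.Landau_Symbols"
begin

text \<open>
  A word is a list, with positions counted from \<open>0\<close>. The library function \<open>nths w J\<close> reads off the
  letters of \<open>w\<close> at the positions in \<open>J\<close> in increasing order, i.e. the subword of \<open>w\<close> indexed by \<open>J\<close>.
  The \<open>r\<close> index sets are \<open>I 0, \<dots>, I (r - 1)\<close>.
\<close>

definition twins :: "nat \<Rightarrow> 'a list \<Rightarrow> nat \<Rightarrow> (nat \<Rightarrow> nat set) \<Rightarrow> bool" where
  "twins r w t I \<longleftrightarrow>
     (\<forall>q<r. I q \<subseteq> {..<length w} \<and> card (I q) = t) \<and>
     disjoint_family_on I {..<r} \<and>
     (\<forall>p<r. \<forall>q<r. nths w (I p) = nths w (I q))"

definition max_twins :: "nat \<Rightarrow> 'a list \<Rightarrow> nat" where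
  "max_twins r w = Max {t. \<exists>I. twins r w t I}"

text \<open>For \<open>r > 0\<close> the maximum ranges over a finite nonempty set (length \<open>0\<close> is always attained).\<close>

lemma twins_empty: "twins r w 0 (\<lambda>_. {})"
  by (simp add: twins_def disjoint_family_on_def)

lemma finite_twins_lengths:
  assumes "r > 0"
  shows "finite {t. \<exists>I. twins r w t I}"
proof (rule finite_subset)
  show "{t. \<exists>I. twins r w t I} \<subseteq> {..length w}"
  proof
    fix t assume "t \<in> {t. \<exists>I. twins r w t I}"
    then obtain I where "I 0 \<subseteq> {..<length w}" "card (I 0) = t"
      using assms by (auto simp: twins_def)
    then show "t \<in> {..length w}"
      using card_mono[of "{..<length w}" "I 0"] by simp
  qed
qed simp

definition random_word :: "'a set \<Rightarrow> nat \<Rightarrow> 'a list pmf" where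
  "random_word A n = pmf_of_set {w. set w \<subseteq> A \<and> length w = n}"

definition Pi_const :: "nat \<Rightarrow> nat \<Rightarrow> real" where
  "Pi_const r k = (\<Prod>j=r+1..k. real j ^ r / (real j ^ r - 1))"

end

theory Submission
  imports Defs
begin

text \<open>
  The function \<open>max_twins r\<close> is superadditive under concatenation, and an exponential moment argument
  shows that it suffices to find, for every \<open>c < Pi_const r k / k\<close>, a single length \<open>n > 0\<close> at which its
  mean is at least \<open>c * n\<close>. This is done by induction on \<open>k\<close>.

  For \<open>k = r\<close> the word is cut into blocks, in each of which all letters are almost equally frequent,
  and the twins read different letters in each block, cyclically shifted.

  For the step, delete the occurrences of a letter \<open>z\<close> from a word over \<open>k + 1\<close> letters, take optimal
  twins of what remains, and insert before the \<open>t\<close>-th letters of the \<open>r\<close> twins as many \<open>z\<close> as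
  precede each of them in the original word. All \<open>r\<close> gaps contain at least \<open>j\<close> copies of \<open>z\<close>
  with probability about \<open>(k + 1) ^ (- j * r)\<close>, and summing over \<open>j\<close> gives the factor
  \<open>(k + 1) ^ r / ((k + 1) ^ r - 1)\<close>.
\<close>

subsection \<open>Twins as colourings\<close>

text \<open>Twins are encoded by colouring the letters: colour \<open>q < r\<close> marks the letters of the \<open>q\<close>-th twin, and
  every other colour marks unused letters.\<close>

definition colour_class :: "nat \<Rightarrow> ('a \<times> nat) list \<Rightarrow> 'a list" where
  "colour_class q xs = map fst (filter (\<lambda>p. snd p = q) xs)"

lemma colour_class_simps [simp]:
  "colour_class q [] = []"
  "colour_class q ((a, c) # xs) = (if c = q then a # colour_class q xs else colour_class q xs)"
  "colour_class q (xs @ ys) = colour_class q xs @ colour_class q ys"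
  "colour_class q (replicate n (a, c)) = (if c = q then replicate n a else [])"
  by (simp_all add: colour_class_def filter_replicate)

lemma colour_class_concat: "colour_class q (concat xss) = concat (map (colour_class q) xss)"
  by (induction xss) auto

lemma colour_class_zip:
  assumes "length cs \<le> length gs"
  shows "colour_class q (zip gs cs) = map ((!) gs) (filter (\<lambda>i. cs ! i = q) [0..<length cs])"
proof -
  have "zip gs cs = map (\<lambda>i. (gs ! i, cs ! i)) [0..<length cs]"
    using assms by (intro nth_equalityI) auto
  then show ?thesis
    by (simp add: colour_class_def filter_map o_def)
qed

text \<open>Brings \<open>nths\<close> to the same shape as \<open>colour_class_zip\<close>, so that
  subwords and colour classes can be compared.\<close>

lemma nths_conv_map_filter: "nths w J = map ((!) w) (filter (\<lambda>i. i \<in> J) [0..<length w])"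
proof -
  have "zip w [0..<length w] = map (\<lambda>i. (w ! i, i)) [0..<length w]"
    by (intro nth_equalityI) auto
  then show ?thesis
    by (simp add: nths_def filter_map o_def)
qed

lemma max_twins_ge:
  assumes "r > 0" "twins r w t I"
  shows "t \<le> max_twins r w"
  unfolding max_twins_def using assms finite_twins_lengths[OF assms(1), of w] by (auto intro: Max_ge)

text \<open>The positions of each colour serve as index sets; they are disjoint because a position
  carries only one colour. The explicit constructions of twins below all use this bound.\<close>

lemma length_colour_class_le_max_twins:
  assumes r: "r > 0" and w: "map fst xs = w" and u: "\<And>q. q < r \<Longrightarrow> colour_class q xs = u"
  shows "length u \<le> max_twins r w"
proof -
  define I where "I q = {i. i < length w \<and> snd (xs ! i) = q}" for q
  have len: "length xs = length w" using w by auto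
  have *: "nths w (I q) = u" if "q < r" for q
  proof -
    have "nths w (I q) = map ((!) w) (filter (\<lambda>i. snd (xs ! i) = q) [0..<length w])"
      unfolding nths_conv_map_filter by (auto simp: I_def intro!: filter_cong arg_cong[where f="map _"])
    also have "\<dots> = colour_class q (zip w (map snd xs))"
      by (subst colour_class_zip) (auto simp: len intro!: filter_cong arg_cong[where f="map _"])
    also have "\<dots> = u" using u[OF that] w by (auto simp: zip_map_fst_snd)
    finally show ?thesis .
  qed
  have "card (I q) = length u" if "q < r" for q
  proof -
    have "length (nths w (I q)) = card (I q)"
      unfolding length_nths by (rule arg_cong[where f=card]) (auto simp: I_def)
    then show ?thesis using *[OF that] by simp
  qed
  then have "twins r w (length u) I"
    using * by (auto simp: twins_def disjoint_family_on_def I_def)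
  then show ?thesis by (rule max_twins_ge[OF r])
qed

lemma max_twins_colouring:
  assumes r: "r > 0"
  obtains xs u where "map fst xs = w" "\<And>q. q < r \<Longrightarrow> colour_class q xs = u"
    "length u = max_twins r w"
proof -
  have "max_twins r w \<in> {t. \<exists>I. twins r w t I}"
    unfolding max_twins_def using finite_twins_lengths[OF r, of w] twins_empty[of r w]
    by (intro Max_in) auto
  then obtain I where I: "twins r w (max_twins r w) I" by auto
  define col where "col i = (if \<exists>q<r. i \<in> I q then THE q. q < r \<and> i \<in> I q else r)" for i
  have col: "col i = q \<longleftrightarrow> i \<in> I q" if "q < r" for i q
  proof -
    have uniq: "p = p'" if "p < r" "p' < r" "i \<in> I p" "i \<in> I p'" for p p'
      using I that unfolding twins_def disjoint_family_on_def by (metis IntI empty_iff lessThan_iff)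
    show ?thesis
    proof (cases "\<exists>q<r. i \<in> I q")
      case True
      then obtain p where p: "p < r" "i \<in> I p" by auto
      then have "(THE q. q < r \<and> i \<in> I q) = p" using uniq by (intro the_equality) auto
      then show ?thesis using True p uniq that by (auto simp: col_def)
    next
      case False
      then show ?thesis using that by (auto simp: col_def)
    qed
  qed
  define xs where "xs = zip w (map col [0..<length w])"
  have *: "colour_class q xs = nths w (I q)" if "q < r" for q
    unfolding xs_def nths_conv_map_filter
    by (subst colour_class_zip) (auto intro!: filter_cong arg_cong[where f="map _"] simp flip: col[OF that])
  have len: "length (nths w (I 0)) = max_twins r w"
  proof -
    have "I 0 \<subseteq> {..<length w}" "card (I 0) = max_twins r w"
      using I r by (auto simp: twins_def)
    moreover from this(1) have "{i. i < length w \<and> i \<in> I 0} = I 0" by auto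
    ultimately show ?thesis by (simp add: length_nths)
  qed
  show thesis
  proof (rule that)
    show "map fst xs = w" by (simp add: xs_def)
    show "colour_class q xs = nths w (I 0)" if "q < r" for q
      using *[OF that] I that r unfolding twins_def by metis
  qed (rule len)
qed

text \<open>Concatenating two colourings concatenates their colour classes, so common words are
  joined to a common word.\<close>

lemma max_twins_append:
  assumes r: "r > 0"
  shows "max_twins r v + max_twins r w \<le> max_twins r (v @ w)"
proof -
  obtain xs u where 1: "map fst xs = v" "\<And>q. q < r \<Longrightarrow> colour_class q xs = u"
    "length u = max_twins r v" using max_twins_colouring[OF r] by blast
  obtain ys u' where 2: "map fst ys = w" "\<And>q. q < r \<Longrightarrow> colour_class q ys = u'"
    "length u' = max_twins r w" using max_twins_colouring[OF r] by blast
  show ?thesis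
    using length_colour_class_le_max_twins[OF r, of "xs @ ys" "v @ w" "u @ u'"] 1 2 by auto
qed

lemma max_twins_le_length:
  assumes r: "r > 0"
  shows "max_twins r w \<le> length w"
proof -
  obtain xs u where 1: "map fst xs = w" "\<And>q. q < r \<Longrightarrow> colour_class q xs = u"
    "length u = max_twins r w" using max_twins_colouring[OF r] by blast
  have "length u \<le> length xs" using 1(2)[OF r] by (auto simp: colour_class_def)
  then show ?thesis using 1 by auto
qed

subsection \<open>Means over words and concentration\<close>

definition words :: "'a set \<Rightarrow> nat \<Rightarrow> 'a list set" where
  "words A n = {w. set w \<subseteq> A \<and> length w = n}"

text \<open>For finite nonempty \<open>A\<close> this is the expectation over a uniform word, kept
  as a finite sum to suit counting arguments; \<open>prob_random_word\<close> gives the link to the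
  probability space.\<close>

definition mean :: "'a set \<Rightarrow> nat \<Rightarrow> ('a list \<Rightarrow> real) \<Rightarrow> real" where
  "mean A n f = (\<Sum>w\<in>words A n. f w) / real (card A) ^ n"

lemma finite_words [simp]: "finite A \<Longrightarrow> finite (words A n)"
  unfolding words_def by (rule finite_lists_length_eq)

lemma card_words: "finite A \<Longrightarrow> card (words A n) = card A ^ n"
  unfolding words_def by (rule card_lists_length_eq)

lemma sum_words_append:
  "(\<Sum>w\<in>words A (m + n). f w) = (\<Sum>u\<in>words A m. \<Sum>v\<in>words A n. f (u @ v))"
proof -
  have "bij_betw (\<lambda>(u, v). u @ v) (words A m \<times> words A n) (words A (m + n))"
  proof (rule bij_betwI[where g = "\<lambda>w. (take m w, drop m w)"])
    show "(\<lambda>w. (take m w, drop m w)) \<in> words A (m + n) \<rightarrow> words A m \<times> words A n"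
      by (auto simp: words_def dest: in_set_takeD in_set_dropD)
  qed (auto simp: words_def)
  from sum.reindex_bij_betw[OF this, of f] show ?thesis
    by (simp add: sum.cartesian_product case_prod_unfold)
qed

text \<open>Expresses that prefix and suffix of a uniform word are independent and uniform.\<close>

lemma mean_append: "mean A (m + n) f = mean A m (\<lambda>u. mean A n (\<lambda>v. f (u @ v)))"
  by (simp add: mean_def sum_words_append sum_divide_distrib power_add field_simps)

lemma mean_mono:
  assumes "\<And>w. w \<in> words A n \<Longrightarrow> f w \<le> g w"
  shows "mean A n f \<le> mean A n g"
  unfolding mean_def using assms by (intro divide_right_mono sum_mono) auto

lemma mean_nonneg: "(\<And>w. w \<in> words A n \<Longrightarrow> 0 \<le> f w) \<Longrightarrow> 0 \<le> mean A n f"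
  unfolding mean_def by (intro divide_nonneg_nonneg sum_nonneg) auto

lemma mean_add: "mean A n (\<lambda>w. f w + g w) = mean A n f + mean A n g"
  by (simp add: mean_def sum.distrib add_divide_distrib)

lemma mean_mult: "mean A n (\<lambda>w. c * f w) = c * mean A n f"
  by (simp add: mean_def sum_distrib_left)

lemma mean_const:
  assumes "finite A" "A \<noteq> {}"
  shows "mean A n (\<lambda>w. c) = c"
  using assms by (simp add: mean_def card_words)

lemma mean_superadditive:
  fixes f :: "'a list \<Rightarrow> real"
  assumes A: "finite A" "A \<noteq> {}" and super: "\<And>u v. f u + f v \<le> f (u @ v)"
  shows "mean A m f + mean A n f \<le> mean A (m + n) f"
proof -
  have "mean A m f + mean A n f = mean A m (\<lambda>u. mean A n (\<lambda>v. f u + f v))"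
    using A by (simp add: mean_add mean_const)
  also have "\<dots> \<le> mean A (m + n) f"
    unfolding mean_append by (intro mean_mono super)
  finally show ?thesis .
qed

text \<open>Cutting a word into \<open>n div m\<close> blocks of length \<open>m\<close> loses only
  a remainder shorter than \<open>m\<close>. One good length thus gives a linear bound at all
  lengths, with a constant loss.\<close>

lemma mean_superadditive_linear_bound:
  fixes f :: "'a list \<Rightarrow> real"
  assumes A: "finite A" "A \<noteq> {}" and super: "\<And>u v. f u + f v \<le> f (u @ v)"
    and nonneg: "\<And>w. 0 \<le> f w" and m: "m > 0" "c * real m \<le> mean A m f" and c: "c \<ge> 0"
  shows "c * real n - c * real m \<le> mean A n f"
proof -
  have "c * real (j * m) \<le> mean A (j * m + s) f" for j s
  proof (induction j)
    case 0
    then show ?case by (simp add: mean_nonneg nonneg)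
  next
    case (Suc j)
    have "mean A m f + mean A (j * m + s) f \<le> mean A (m + (j * m + s)) f"
      by (rule mean_superadditive[OF A super])
    then show ?case using m Suc by (simp add: algebra_simps)
  qed
  from this[of "n div m" "n mod m"]
  have "c * real (n div m * m) \<le> mean A n f" by simp
  moreover have "real n - real m \<le> real (n div m * m)"
    using m by (simp add: minus_mod_eq_div_mult[symmetric])
  then have "c * (real n - real m) \<le> c * real (n div m * m)"
    using c by (rule mult_left_mono)
  ultimately show ?thesis by (simp add: algebra_simps)
qed

section \<open>Lower tails of superadditive functions\<close>

lemma exp_minus_le_quadratic:
  fixes y :: real
  assumes "y \<ge> 0"
  shows "exp (- y) \<le> 1 - y + y\<^sup>2"
proof -
  \<comment> \<open>This is \<open>1 + y \<le> exp y\<close> inverted.\<close>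
  have "exp (- y) \<le> 1 / (1 + y)"
    using assms by (simp add: exp_minus field_simps)
  also have "\<dots> \<le> 1 - y + y\<^sup>2"
  proof -
    have "(1 - y + y\<^sup>2) * (1 + y) = 1 + y ^ 3" by algebra
    then have "1 \<le> (1 - y + y\<^sup>2) * (1 + y)" using assms by simp
    then show ?thesis using assms by (simp add: divide_le_eq)
  qed
  finally show ?thesis .
qed

text \<open>A Chernoff bound for the lower tail: superadditivity replaces independence of summands,
  and a single length \<open>m\<close> with a large mean already forces exponential decay.\<close>

lemma prob_superadditive_less_tendsto_0:
  fixes f :: "'a list \<Rightarrow> real"
  assumes A: "finite A" "A \<noteq> {}"
    and super: "\<And>u v. f u + f v \<le> f (u @ v)"
    and nonneg: "\<And>w. 0 \<le> f w" and le: "\<And>w. f w \<le> real (length w)"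
    and m: "m > 0" "c * real m \<le> mean A m f" and \<epsilon>: "\<epsilon> > 0"
  shows "(\<lambda>n. mean A n (\<lambda>w. of_bool (f w < (c - \<epsilon>) * real n))) \<longlonglongrightarrow> 0"
proof (cases "c \<le> \<epsilon>")
  case True
  have "mean A n (\<lambda>w. of_bool (f w < (c - \<epsilon>) * real n)) = mean A n (\<lambda>w. 0)" for n
  proof -
    \<comment> \<open>In this case the event is empty, since \<open>f\<close> is
      nonnegative.\<close>
    have "(c - \<epsilon>) * real n \<le> 0" using True by (intro mult_nonpos_nonneg) auto
    then have "\<not> f w < (c - \<epsilon>) * real n" for w
      using nonneg[of w] by linarith
    then show ?thesis by simp
  qed
  then show ?thesis using A by (simp add: mean_const)
next
  case False
  \<comment> \<open>Markov's inequality for \<open>exp (- (l * f w))\<close>, whose mean \<open>\<phi>\<close> is submultiplicative in the length\<close>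
  define l where "l = \<epsilon> / (2 * real m)"
  have l: "l > 0" "l * real m = \<epsilon> / 2" using \<epsilon> m by (auto simp: l_def)
  define \<phi> where "\<phi> n = mean A n (\<lambda>w. exp (- (l * f w)))" for n
  have \<phi>_nonneg: "0 \<le> \<phi> n" for n unfolding \<phi>_def by (intro mean_nonneg) auto
  have \<phi>_add: "\<phi> (i + n) \<le> \<phi> i * \<phi> n" for i n
  proof -
    have "\<phi> (i + n) \<le> mean A i (\<lambda>u. mean A n (\<lambda>v. exp (- (l * f u)) * exp (- (l * f v))))"
      unfolding \<phi>_def mean_append
    proof (intro mean_mono)
      fix u v
      have "l * (f u + f v) \<le> l * f (u @ v)" using super l by (intro mult_left_mono) auto
      then show "exp (- (l * f (u @ v))) \<le> exp (- (l * f u)) * exp (- (l * f v))"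
        by (simp add: exp_add[symmetric] algebra_simps)
    qed
    also have "\<dots> = \<phi> i * \<phi> n"
      by (simp add: \<phi>_def mean_mult mult.commute[of _ "mean A n _"])
    finally show ?thesis .
  qed
  have \<phi>_le_1: "\<phi> n \<le> 1" for n
  proof -
    have "\<phi> n \<le> mean A n (\<lambda>_. 1)"
      unfolding \<phi>_def using l nonneg by (intro mean_mono) auto
    then show ?thesis using A by (simp add: mean_const)
  qed
  \<comment> \<open>The choice of \<open>l\<close> makes the quadratic error
    \<open>(l * m)^2\<close> equal to \<open>l * m * \<epsilon> / 2\<close>. So
    \<open>\<beta>\<close> gives up half of the slack \<open>\<epsilon>\<close>; the other half
    produces the decay in \<open>bound\<close>.\<close>
  define \<beta> where "\<beta> = l * (c - \<epsilon> / 2)"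
  have \<beta>: "\<beta> \<ge> 0" using l False \<epsilon> by (auto simp: \<beta>_def)
  have \<phi>_m: "\<phi> m \<le> exp (- (\<beta> * real m))"
  proof -
    have "\<phi> m \<le> mean A m (\<lambda>w. (1 + (l * real m)\<^sup>2) + (- l) * f w)"
      unfolding \<phi>_def
    proof (intro mean_mono)
      fix w assume w: "w \<in> words A m"
      \<comment> \<open>Bounding \<open>f\<close> by the length turns the quadratic term into a
        constant, so only the mean of \<open>f\<close> enters.\<close>
      have "l * f w \<le> l * real m" using le[of w] w l by (intro mult_left_mono) (auto simp: words_def)
      then have "(l * f w)\<^sup>2 \<le> (l * real m)\<^sup>2" using l nonneg by (intro power_mono) auto
      moreover have "exp (- (l * f w)) \<le> 1 - l * f w + (l * f w)\<^sup>2"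
        using l nonneg by (intro exp_minus_le_quadratic) auto
      ultimately show "exp (- (l * f w)) \<le> (1 + (l * real m)\<^sup>2) + (- l) * f w" by simp
    qed
    also have "\<dots> = 1 + (l * real m)\<^sup>2 - l * mean A m f"
      by (simp only: mean_add mean_mult mean_const[OF A])
    also have "\<dots> \<le> 1 + (l * real m)\<^sup>2 - l * (c * real m)"
      using m l by auto
    also have "\<dots> = 1 + (- (\<beta> * real m))"
    proof -
      have "\<beta> * real m = l * (c * real m) - (l * real m) * (\<epsilon> / 2)"
        by (simp add: \<beta>_def algebra_simps)
      moreover have "(l * real m)\<^sup>2 = (l * real m) * (\<epsilon> / 2)"
        unfolding power2_eq_square l(2) ..
      ultimately show ?thesis by linarith
    qed
    also have "\<dots> \<le> exp (- (\<beta> * real m))" by (rule exp_ge_add_one_self)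
    finally show ?thesis .
  qed
  have \<phi>_bound: "\<phi> n \<le> exp (- (\<beta> * (real n - real m)))" for n
  proof -
    have "\<phi> (j * m + s) \<le> exp (- (\<beta> * real (j * m)))" for j s
    proof (induction j)
      case 0
      then show ?case using \<phi>_le_1 by simp
    next
      case (Suc j)
      have "\<phi> (m + (j * m + s)) \<le> \<phi> m * \<phi> (j * m + s)" by (rule \<phi>_add)
      also have "\<dots> \<le> exp (- (\<beta> * real m)) * exp (- (\<beta> * real (j * m)))"
        using \<phi>_nonneg \<phi>_m Suc by (intro mult_mono) auto
      also have "\<dots> = exp (- (\<beta> * real (Suc j * m)))"
        by (simp add: exp_add[symmetric] algebra_simps)
      finally show ?case by (simp add: algebra_simps)
    qed
    from this[of "n div m" "n mod m"]
    have "\<phi> n \<le> exp (- (\<beta> * real (n div m * m)))" by simp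
    also have "real n - real m \<le> real (n div m * m)"
      using m by (simp add: minus_mod_eq_div_mult[symmetric])
    then have "\<beta> * (real n - real m) \<le> \<beta> * real (n div m * m)"
      using \<beta> by (rule mult_left_mono)
    then have "exp (- (\<beta> * real (n div m * m))) \<le> exp (- (\<beta> * (real n - real m)))"
      by simp
    finally show ?thesis .
  qed
  have bound: "mean A n (\<lambda>w. of_bool (f w < (c - \<epsilon>) * real n))
      \<le> exp (\<beta> * real m - (l * \<epsilon> / 2) * real n)" for n
  proof -
    have "mean A n (\<lambda>w. of_bool (f w < (c - \<epsilon>) * real n))
        \<le> mean A n (\<lambda>w. exp (l * ((c - \<epsilon>) * real n)) * exp (- (l * f w)))"
      using l by (intro mean_mono) (auto simp: exp_add[symmetric] mult_le_cancel_left_pos)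
    also have "\<dots> = exp (l * ((c - \<epsilon>) * real n)) * \<phi> n"
      by (simp add: mean_mult \<phi>_def)
    also have "\<dots> \<le> exp (l * ((c - \<epsilon>) * real n)) * exp (- (\<beta> * (real n - real m)))"
      by (intro mult_left_mono \<phi>_bound) auto
    also have "\<dots> = exp (\<beta> * real m - (l * \<epsilon> / 2) * real n)"
      unfolding exp_add[symmetric] \<beta>_def by (rule arg_cong[where f = exp]) (simp add: field_simps)
    finally show ?thesis .
  qed
  have lim: "(\<lambda>n. exp (\<beta> * real m - (l * \<epsilon> / 2) * real n)) \<longlonglongrightarrow> 0"
  proof -
    have "(\<lambda>n. exp (a - d * real n)) \<longlonglongrightarrow> 0" if "d > 0" for a d :: real
      using that by real_asymp
    moreover have "l * \<epsilon> / 2 > 0" using l \<epsilon> by simp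
    ultimately show ?thesis by blast
  qed
  show ?thesis
    by (rule tendsto_sandwich[OF _ _ tendsto_const lim]; intro always_eventually allI bound mean_nonneg) simp
qed

subsection \<open>As many letters as twins\<close>

lemma colouring_of_letter_counts:
  assumes "inj_on \<sigma> Q" "Q \<subseteq> {..<r}" "\<And>q. q \<in> Q \<Longrightarrow> N q \<le> count_list B (\<sigma> q)"
  shows "\<exists>xs. map fst xs = B \<and>
    (\<forall>q<r. colour_class q xs = (if q \<in> Q then replicate (N q) (\<sigma> q) else []))"
  using assms(3)
proof (induction B arbitrary: N)
  case Nil
  then show ?case by (auto intro!: exI[of _ "[]"])
next
  case (Cons a B)
  show ?case
  proof (cases "\<exists>q\<in>Q. \<sigma> q = a \<and> N q > 0")
    case True
    then obtain q where q: "q \<in> Q" "\<sigma> q = a" "N q > 0" by auto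
    have *: "\<sigma> p \<noteq> a" if "p \<in> Q" "p \<noteq> q" for p
      using that q assms(1) by (auto simp: inj_on_def)
    have "\<exists>xs. map fst xs = B \<and> (\<forall>p<r. colour_class p xs =
        (if p \<in> Q then replicate ((N(q := N q - 1)) p) (\<sigma> p) else []))"
    proof (rule Cons.IH)
      fix p assume p: "p \<in> Q"
      show "(N(q := N q - 1)) p \<le> count_list B (\<sigma> p)"
      proof (cases "p = q")
        case True
        then show ?thesis using Cons.prems[OF q(1)] q by simp
      next
        case False
        then show ?thesis using Cons.prems[OF p] *[OF p False] by simp
      qed
    qed
    then obtain xs where xs: "map fst xs = B" "\<And>p. p < r \<Longrightarrow> colour_class p xs =
        (if p \<in> Q then replicate ((N(q := N q - 1)) p) (\<sigma> p) else [])" by blast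
    have "colour_class p ((a, q) # xs) = (if p \<in> Q then replicate (N p) (\<sigma> p) else [])"
      if "p < r" for p
      using xs(2) that q by (cases "N q") auto
    then show ?thesis using xs(1) by (intro exI[of _ "(a, q) # xs"]) auto
  next
    case False
    have "\<exists>xs. map fst xs = B \<and> (\<forall>p<r. colour_class p xs =
        (if p \<in> Q then replicate (N p) (\<sigma> p) else []))"
    proof (rule Cons.IH)
      fix p assume p: "p \<in> Q"
      show "N p \<le> count_list B (\<sigma> p)"
      proof (cases "\<sigma> p = a")
        case True
        then show ?thesis using False p by simp
      next
        case False
        then show ?thesis using Cons.prems[OF p] by simp
      qed
    qed
    then obtain xs where xs: "map fst xs = B" "\<And>p. p < r \<Longrightarrow> colour_class p xs =
        (if p \<in> Q then replicate (N p) (\<sigma> p) else [])" by blast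
    then show ?thesis using assms(2) by (intro exI[of _ "(a, r) # xs"]) auto
  qed
qed

text \<open>The twin with index \<open>q\<close> reads the letter \<open>e (i mod r)\<close> in block \<open>i + q\<close>; thus within every
  block the \<open>r\<close> twins read pairwise different letters.\<close>

lemma max_twins_concat_balanced_blocks:
  assumes r: "r > 0" and len: "length Bs = M + r"
    and e: "inj_on e {..<r}"
    and count: "\<And>B i. B \<in> set Bs \<Longrightarrow> i < r \<Longrightarrow> s \<le> count_list B (e i)"
  shows "M * s \<le> max_twins r (concat Bs)"
proof -
  \<comment> \<open>The twins active in block \<open>j\<close>: twin \<open>q\<close> uses the
    \<open>M\<close> blocks from \<open>q\<close> to \<open>q + M - 1\<close>, all of index below
    \<open>M + r\<close>. Near both ends only some twins are active.\<close>
  define Q where "Q j = {q. q < r \<and> q \<le> j \<and> j < q + M}" for j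
  define \<sigma> where "\<sigma> j q = e ((j - q) mod r)" for j q
  have "\<exists>xs. map fst xs = Bs ! j \<and>
      (\<forall>q<r. colour_class q xs = (if q \<in> Q j then replicate s (\<sigma> j q) else []))"
    if j: "j < M + r" for j
  proof (rule colouring_of_letter_counts)
    show "Q j \<subseteq> {..<r}" by (auto simp: Q_def)
    show "inj_on (\<sigma> j) (Q j)"
    proof (rule inj_onI)
      fix p q assume pq: "p \<in> Q j" "q \<in> Q j" "\<sigma> j p = \<sigma> j q"
      then have *: "(j - p) mod r = (j - q) mod r"
        using inj_onD[OF e] r by (auto simp: \<sigma>_def)
      have "p = q" if "p \<in> Q j" "q \<in> Q j" "p \<le> q" "(j - p) mod r = (j - q) mod r" for p q
      proof -
        \<comment> \<open>Two twins reading the same letter have indices differing by a multiple of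
          \<open>r\<close>, but both indices are below \<open>r\<close>.\<close>
        have "r dvd (j - p) - (j - q)"
          using that by (subst mod_eq_dvd_iff_nat[symmetric]) auto
        also have "(j - p) - (j - q) = q - p" using that by (auto simp: Q_def)
        finally show ?thesis using that by (auto simp: Q_def dest: dvd_imp_le)
      qed
      then show "p = q" using pq(1,2) * by (metis nat_le_linear)
    qed
    fix q assume "q \<in> Q j"
    show "s \<le> count_list (Bs ! j) (\<sigma> j q)"
      unfolding \<sigma>_def using r j len by (intro count) auto
  qed
  then obtain X where X: "\<And>j. j < M + r \<Longrightarrow> map fst (X j) = Bs ! j"
    "\<And>j q. j < M + r \<Longrightarrow> q < r \<Longrightarrow>
       colour_class q (X j) = (if q \<in> Q j then replicate s (\<sigma> j q) else [])"
    by metis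
  define xs where "xs = concat (map X [0..<M + r])"
  define u where "u = concat (map (\<lambda>i. replicate s (e (i mod r))) [0..<M])"
  have "map fst xs = concat (map (\<lambda>j. Bs ! j) [0..<M + r])"
    unfolding xs_def map_concat by (auto simp: X o_def intro!: arg_cong[where f=concat])
  also have "\<dots> = concat Bs" using len by (metis map_nth)
  finally have fst: "map fst xs = concat Bs" .
  have "colour_class q xs = u" if q: "q < r" for q
  proof -
    \<comment> \<open>The blocks before, during and after the activity of twin \<open>q\<close>;
      only the middle range contributes letters.\<close>
    have split: "[0..<M + r] = [0..<q] @ [q..<q + M] @ [q + M..<M + r]"
      using q upt_add_eq_append[of 0 q "M + (r - q)"] upt_add_eq_append[of q "q + M" "r - q"]
      by (simp add: add.assoc)
    have shift: "[q..<q + M] = map (\<lambda>i. i + q) [0..<M]"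
      by (simp add: map_add_upt add.commute)
    have "colour_class q xs = concat (map (\<lambda>j. if q \<in> Q j then replicate s (\<sigma> j q) else []) [0..<M + r])"
      unfolding xs_def colour_class_concat using X(2) q
      by (auto simp: o_def intro!: arg_cong[where f=concat])
    also have "\<dots> = u"
    proof -
      define F where "F j = (if q \<in> Q j then replicate s (\<sigma> j q) else [])" for j
      have 1: "map F [0..<q] = map (\<lambda>_. []) [0..<q]"
        and 2: "map F [q + M..<M + r] = map (\<lambda>_. []) [q + M..<M + r]"
        by (auto simp: F_def Q_def)
      have 3: "map (\<lambda>i. F (i + q)) [0..<M] = map (\<lambda>i. replicate s (e (i mod r))) [0..<M]"
        using q by (auto simp: F_def Q_def \<sigma>_def)
      have 4: "concat (map (\<lambda>_. []) L) = []" for L :: "nat list"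
        by simp
      have "map F [0..<M + r] = map F [0..<q] @ map (\<lambda>i. F (i + q)) [0..<M] @ map F [q + M..<M + r]"
        unfolding split shift by (simp add: o_def)
      then have "concat (map F [0..<M + r]) = u"
        unfolding 1 2 3 u_def by (simp only: concat_append 4 append_Nil append_Nil2)
      then show ?thesis unfolding F_def .
    qed
    finally show ?thesis .
  qed
  moreover have "length u = M * s"
    by (simp add: u_def length_concat o_def sum_list_triv)
  ultimately show ?thesis
    using length_colour_class_le_max_twins[OF r fst, of u] by simp
qed

section \<open>Balanced blocks in a random word\<close>

lemma mean_eq_card:
  assumes "finite A"
  shows "mean A n (\<lambda>w. of_bool (P w)) = real (card {w \<in> words A n. P w}) / real (card A) ^ n"
  using assms by (simp add: mean_def sum_of_bool_eq Int_def conj_commute)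

lemma mean_count_list:
  assumes "finite A" "a \<in> A"
  shows "mean A 1 (\<lambda>w. real (count_list w a)) = 1 / real (card A)"
proof -
  have "words A 1 = (\<lambda>b. [b]) ` A"
    by (auto simp: words_def length_Suc_conv image_iff)
  then have "(\<Sum>w\<in>words A 1. real (count_list w a)) = (\<Sum>b\<in>A. if b = a then 1 else 0)"
    by (simp add: sum.reindex inj_on_def if_distrib cong: if_cong)
  then show ?thesis using assms by (simp add: mean_def)
qed

text \<open>Letter counts are additive under concatenation and have mean \<open>1 / card A\<close>
  at length \<open>1\<close>, so the tail bound applies to each letter; a union bound over
  \<open>A\<close> finishes.\<close>

lemma mean_balanced_tendsto_1:
  assumes A: "finite A" "A \<noteq> {}" and c: "c < 1 / real (card A)"
  shows "(\<lambda>b. mean A b (\<lambda>w. of_bool (\<forall>a\<in>A. c * real b \<le> real (count_list w a)))) \<longlonglongrightarrow> 1"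
proof -
  define bad where "bad a b = mean A b (\<lambda>w. of_bool (real (count_list w a) < c * real b))" for a b
  have "bad a \<longlonglongrightarrow> 0" if "a \<in> A" for a
    unfolding bad_def
    using prob_superadditive_less_tendsto_0[of A "\<lambda>w. real (count_list w a)" 1 "1 / real (card A)"
        "1 / real (card A) - c"] mean_count_list[OF A(1) that] A c
    by (simp add: count_le_length)
  then have "(\<lambda>b. 1 - (\<Sum>a\<in>A. bad a b)) \<longlonglongrightarrow> 1 - (\<Sum>a\<in>A. 0)"
    by (intro tendsto_intros) auto
  then have lim: "(\<lambda>b. 1 - (\<Sum>a\<in>A. bad a b)) \<longlonglongrightarrow> 1" by simp
  show ?thesis
  proof (rule tendsto_sandwich[OF _ _ lim tendsto_const]; intro always_eventually allI)
    fix b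
    have "1 = mean A b (\<lambda>w. 1)" using A by (simp add: mean_const)
    also have "\<dots> \<le> mean A b (\<lambda>w. of_bool (\<forall>a\<in>A. c * real b \<le> real (count_list w a))
        + (\<Sum>a\<in>A. of_bool (real (count_list w a) < c * real b)))"
    proof (intro mean_mono)
      fix w
      show "1 \<le> of_bool (\<forall>a\<in>A. c * real b \<le> real (count_list w a))
        + (\<Sum>a\<in>A. of_bool (real (count_list w a) < c * real b) :: real)"
      proof (cases "\<forall>a\<in>A. c * real b \<le> real (count_list w a)")
        case False
        then obtain a where a: "a \<in> A" "real (count_list w a) < c * real b" by force
        then show ?thesis
          using member_le_sum[of a A "\<lambda>a. of_bool (real (count_list w a) < c * real b) :: real"] A by simp
      qed (simp add: sum_nonneg)
    qed
    also have "\<dots> = mean A b (\<lambda>w. of_bool (\<forall>a\<in>A. c * real b \<le> real (count_list w a)))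
        + (\<Sum>a\<in>A. bad a b)"
      unfolding mean_add bad_def mean_def
      by (simp only: sum.swap[of _ A] sum_divide_distrib)
    finally show "1 - (\<Sum>a\<in>A. bad a b) \<le> mean A b (\<lambda>w. of_bool (\<forall>a\<in>A. c * real b \<le> real (count_list w a)))"
      by simp
  next
    fix b
    have "mean A b (\<lambda>w. of_bool (\<forall>a\<in>A. c * real b \<le> real (count_list w a))) \<le> mean A b (\<lambda>w. 1)"
      by (intro mean_mono) auto
    then show "mean A b (\<lambda>w. of_bool (\<forall>a\<in>A. c * real b \<le> real (count_list w a))) \<le> 1"
      using A by (simp add: mean_const)
  qed
qed

text \<open>Independence of the \<open>N\<close> blocks, by counting: \<open>concat\<close> is
  injective on lists of \<open>N\<close> blocks of common length \<open>b\<close>.\<close>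

lemma mean_of_bool_concat_ge:
  assumes A: "finite A"
  shows "mean A b (\<lambda>w. of_bool (P w)) ^ N
    \<le> mean A (N * b) (\<lambda>w. of_bool (\<exists>Bs. length Bs = N \<and>
        (\<forall>B\<in>set Bs. B \<in> words A b \<and> P B) \<and> w = concat Bs))"
    (is "_ \<le> mean A (N * b) (\<lambda>w. of_bool (?Q w))")
proof -
  define G where "G = {w \<in> words A b. P w}"
  have G: "finite G" unfolding G_def using A by simp
  define S where "S = {Bs. set Bs \<subseteq> G \<and> length Bs = N}"
  have len: "length (concat Bs) = N * b" if "Bs \<in> S" for Bs
  proof -
    have "map length Bs = map (\<lambda>_. b) Bs" using that by (auto simp: S_def G_def words_def)
    then have "length (concat Bs) = length Bs * b"
      unfolding length_concat by (simp only: sum_list_triv) simp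
    then show ?thesis using that by (simp add: S_def)
  qed
  have "inj_on concat S"
  proof (rule inj_onI)
    fix x y assume *: "x \<in> S" "y \<in> S" "concat x = concat y"
    show "x = y"
    proof (rule concat_injective)
      show "\<forall>(x, y)\<in>set (zip x y). length x = length y"
      proof clarify
        fix a d assume "(a, d) \<in> set (zip x y)"
        then have "a \<in> G" "d \<in> G"
          using * by (auto simp: S_def dest: set_zip_leftD set_zip_rightD)
        then show "length a = length d" by (simp add: G_def words_def)
      qed
    qed (use * in \<open>auto simp: S_def\<close>)
  qed
  then have "card G ^ N = card (concat ` S)"
    using card_lists_length_eq[OF G, of N] by (simp add: card_image S_def)
  also have "\<dots> \<le> card {w \<in> words A (N * b). ?Q w}"
  proof (rule card_mono)
    show "concat ` S \<subseteq> {w \<in> words A (N * b). ?Q w}"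
    proof
      fix w assume "w \<in> concat ` S"
      then obtain Bs where Bs: "Bs \<in> S" "w = concat Bs" by auto
      then have "w \<in> words A (N * b)" using len[OF Bs(1)] by (auto simp: S_def G_def words_def)
      then show "w \<in> {w \<in> words A (N * b). ?Q w}"
        using Bs by (auto simp: S_def G_def)
    qed
  qed (use A in simp)
  finally have *: "real (card G ^ N) \<le> real (card {w \<in> words A (N * b). ?Q w})"
    unfolding of_nat_le_iff .
  have "mean A b (\<lambda>w. of_bool (P w)) ^ N = real (card G ^ N) / real (card A) ^ (N * b)"
    by (simp add: mean_eq_card[OF A] G_def power_divide power_mult[symmetric] mult.commute)
  then show ?thesis
    unfolding mean_eq_card[OF A] using * by (simp add: divide_right_mono)
qed

text \<open>Base case of the induction on the alphabet: when all \<open>M + r\<close> blocks are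
  balanced, which is likely, the cyclic construction yields twins of length
  \<open>M * s\<close>.\<close>

lemma mean_max_twins_card_eq:
  assumes r: "r > 0" and A: "finite A" "card A = r" and c: "c < 1 / real r"
  shows "\<exists>n>0. c * real n \<le> mean A n (\<lambda>w. real (max_twins r w))"
proof (cases "c \<le> 0")
  case True
  then have "c \<le> mean A 1 (\<lambda>w. real (max_twins r w))"
    by (intro order.trans[OF True] mean_nonneg) auto
  then show ?thesis by (intro exI[of _ 1]) auto
next
  case False
  have A': "A \<noteq> {}" using r A by auto
  \<comment> \<open>The gap between \<open>c2\<close> and \<open>1 / r\<close> absorbs the
    fluctuation of letter counts, the one between \<open>c1\<close> and \<open>c2\<close> the
    \<open>r\<close> surplus blocks, and the one between \<open>c\<close> and \<open>c1\<close> the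
    unbalanced words.\<close>
  obtain c1 where c1: "c < c1" "c1 < 1 / real r" using dense[OF c] by blast
  obtain c2 where c2: "c1 < c2" "c2 < 1 / real r" using dense[OF c1(2)] by blast
  obtain M where M: "real M > c1 * real r / (c2 - c1)" using reals_Archimedean2 by blast
  then have M: "c1 * real (M + r) \<le> c2 * real M"
    using c2 by (simp add: field_simps)
  define p where "p b = mean A b (\<lambda>w. of_bool (\<forall>a\<in>A. c2 * real b \<le> real (count_list w a)))" for b
  \<comment> \<open>The number of blocks is fixed before the block length \<open>b\<close> grows, so
    the exponent is constant.\<close>
  have "(\<lambda>b. p b ^ (M + r)) \<longlonglongrightarrow> 1 ^ (M + r)"
    unfolding p_def using mean_balanced_tendsto_1[OF A(1) A', of c2] c2 A by (intro tendsto_power) simp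
  moreover have "c / c1 < 1" using c1 False by simp
  ultimately have "eventually (\<lambda>b. c / c1 < p b ^ (M + r) \<and> b > 0) sequentially"
    by (intro eventually_conj eventually_gt_at_top order_tendstoD(1)[where y = 1]) simp_all
  then obtain b where b: "c / c1 < p b ^ (M + r)" "b > 0"
    by (auto dest: eventually_happens)
  obtain e where e: "bij_betw e {..<r} A"
    using ex_bij_betw_nat_finite[OF A(1)] A(2) by (auto simp: atLeast0LessThan)
  define s where "s = nat \<lceil>c2 * real b\<rceil>"
  have s: "c2 * real b \<le> real s" unfolding s_def by linarith
  define good where "good w \<longleftrightarrow> (\<exists>Bs. length Bs = M + r \<and>
    (\<forall>B\<in>set Bs. B \<in> words A b \<and> (\<forall>a\<in>A. c2 * real b \<le> real (count_list B a))) \<and> w = concat Bs)" for w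
  have pos: "0 < c1" "0 < c2" using False c1 c2 by auto
  have p_nonneg: "0 \<le> p b ^ (M + r)" unfolding p_def by (intro zero_le_power mean_nonneg) simp
  have "c * real ((M + r) * b) = (c / c1) * ((c1 * real (M + r)) * real b)"
    using c1 False by simp
  also have "\<dots> \<le> p b ^ (M + r) * ((c2 * real M) * real b)"
    by (rule mult_mono[OF less_imp_le[OF b(1)] mult_right_mono[OF M]]) (use pos p_nonneg in simp_all)
  also have "\<dots> = p b ^ (M + r) * (real M * (c2 * real b))"
    by simp
  also have "\<dots> \<le> mean A ((M + r) * b) (\<lambda>w. of_bool (good w)) * (real M * real s)"
    unfolding p_def good_def using pos s
    by (intro mult_mono mean_of_bool_concat_ge[OF A(1)] mult_nonneg_nonneg mean_nonneg) auto
  also have "\<dots> = mean A ((M + r) * b) (\<lambda>w. (real M * real s) * of_bool (good w))"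
    by (simp add: mean_mult)
  also have "\<dots> \<le> mean A ((M + r) * b) (\<lambda>w. real (max_twins r w))"
  proof (intro mean_mono)
    fix w
    show "(real M * real s) * of_bool (good w) \<le> real (max_twins r w)"
    proof (cases "good w")
      case True
      then obtain Bs where Bs: "length Bs = M + r" "w = concat Bs"
        "\<And>B a. B \<in> set Bs \<Longrightarrow> a \<in> A \<Longrightarrow> c2 * real b \<le> real (count_list B a)"
        by (auto simp: good_def)
      have "M * s \<le> max_twins r w"
        unfolding Bs(2)
      proof (rule max_twins_concat_balanced_blocks[OF r Bs(1)])
        show "inj_on e {..<r}" using e by (auto simp: bij_betw_def)
        fix B i assume "B \<in> set Bs" "i < r"
        then have "c2 * real b \<le> real (count_list B (e i))"
          using Bs(3) e by (auto simp: bij_betw_def)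
        then show "s \<le> count_list B (e i)" by (simp add: s_def ceiling_le_iff nat_le_iff)
      qed
      then show ?thesis using True by (simp flip: of_nat_mult)
    qed simp
  qed
  finally show ?thesis using b r by (intro exI[of _ "(M + r) * b"]) auto
qed

subsection \<open>Adding a letter\<close>

text \<open>The list \<open>gs\<close> holds the lengths of the runs of \<open>z\<close> before each letter of \<open>v\<close> and, as its last entry,
  after all of them; it is meant to have length \<open>Suc (length v)\<close>.\<close>

primrec weave :: "'a \<Rightarrow> 'a list \<Rightarrow> nat list \<Rightarrow> 'a list" where
  "weave z [] gs = replicate (hd gs) z"
| "weave z (a # v) gs = replicate (hd gs) z @ a # weave z v (tl gs)"

text \<open>The weak compositions of \<open>s\<close> into \<open>l\<close> parts: the ways of
  distributing \<open>s\<close> copies of the new letter over \<open>l\<close> gaps.\<close>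

definition gap_lists :: "nat \<Rightarrow> nat \<Rightarrow> nat list set" where
  "gap_lists l s = {gs. length gs = l \<and> sum_list gs = s}"

lemma finite_gap_lists [simp]: "finite (gap_lists l s)"
proof (rule finite_subset)
  show "gap_lists l s \<subseteq> {gs. set gs \<subseteq> {..s} \<and> length gs = l}"
    by (auto simp: gap_lists_def member_le_sum_list)
qed (rule finite_lists_length_eq, simp)

text \<open>Stars and bars; for \<open>s = n - m\<close> with \<open>m \<le> n\<close> this is
  \<open>n choose m\<close>.\<close>

lemma card_gap_lists: "card (gap_lists (Suc m) s) = (s + m) choose m"
  unfolding gap_lists_def by (subst card_length_sum_list) (simp add: binomial_symmetric[of s])

lemma length_weave: "length gs = Suc (length v) \<Longrightarrow> length (weave z v gs) = length v + sum_list gs"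
proof (induction v arbitrary: gs)
  case (Cons a v)
  then show ?case by (cases gs) auto
qed (auto simp: length_Suc_conv)

lemma filter_weave: "z \<notin> set v \<Longrightarrow> filter (\<lambda>a. a \<noteq> z) (weave z v gs) = v"
  by (induction v arbitrary: gs) auto

lemma set_weave: "set (weave z v gs) \<subseteq> insert z (set v)"
  by (induction v arbitrary: gs) auto

text \<open>The first run of \<open>z\<close> stops at the first letter of \<open>v\<close>, which
  differs from \<open>z\<close>; recursion yields the other gaps. With \<open>filter_weave\<close>,
  both \<open>v\<close> and \<open>gs\<close> can be recovered from the woven word.\<close>

lemma weave_eq_imp_gaps_eq:
  assumes "weave z v gs = weave z v gs'" "z \<notin> set v"
    "length gs = Suc (length v)" "length gs' = Suc (length v)"
  shows "gs = gs'"
  using assms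
proof (induction v arbitrary: gs gs')
  case Nil
  then show ?case by (auto simp: length_Suc_conv dest: arg_cong[where f=length])
next
  case (Cons a v)
  obtain g hs g' hs' where gs: "gs = g # hs" "gs' = g' # hs'"
    using Cons.prems(3,4) by (auto simp: length_Suc_conv)
  have "length (takeWhile (\<lambda>x. x = z) (replicate n z @ a # w)) = n" for n w
    using Cons.prems(2) by (subst takeWhile_append2) auto
  then have "g = g'" using Cons.prems(1) gs by (metis weave.simps(2) list.sel(1))
  moreover have "hs = hs'"
    using Cons.prems gs \<open>g = g'\<close> by (intro Cons.IH) auto
  ultimately show ?case using gs by simp
qed

text \<open>Before each letter of a twin, the nearest \<open>h\<close> of the \<open>g\<close>
  inserted copies of \<open>z\<close> receive the colour of that letter. Each copy precedes only one
  letter, so the twins do not conflict.\<close>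

lemma colouring_weave:
  assumes "length gs = Suc (length xs)"
    "\<And>q. q < r \<Longrightarrow> list_all2 (\<le>) (Hs q) (colour_class q (zip gs (map snd xs)))"
  shows "\<exists>ys. map fst ys = weave z (map fst xs) gs \<and> (\<forall>q<r. colour_class q ys =
    concat (map2 (\<lambda>h a. replicate h z @ [a]) (Hs q) (colour_class q xs)))"
  using assms
proof (induction xs arbitrary: gs Hs)
  case Nil
  then show ?case by (intro exI[of _ "replicate (hd gs) (z, r)"]) auto
next
  case (Cons x xs)
  obtain a c where x: "x = (a, c)" by (cases x)
  obtain g gs' where gs: "gs = g # gs'" "length gs' = Suc (length xs)"
    using Cons.prems(1) by (auto simp: length_Suc_conv)
  show ?case
  proof (cases "c < r")
    case True
    then obtain h hs where h: "Hs c = h # hs" "h \<le> g"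
        "list_all2 (\<le>) hs (colour_class c (zip gs' (map snd xs)))"
      using Cons.prems(2)[of c] x gs by (auto simp: list_all2_Cons2)
    have "\<exists>ys. map fst ys = weave z (map fst xs) gs' \<and> (\<forall>q<r. colour_class q ys =
      concat (map2 (\<lambda>h a. replicate h z @ [a]) ((Hs(c := hs)) q) (colour_class q xs)))"
    proof (rule Cons.IH[OF gs(2)])
      fix q assume "q < r"
      then show "list_all2 (\<le>) ((Hs(c := hs)) q) (colour_class q (zip gs' (map snd xs)))"
        using Cons.prems(2)[of q] x gs h by auto
    qed
    then obtain ys where ys: "map fst ys = weave z (map fst xs) gs'" "\<And>q. q < r \<Longrightarrow> colour_class q ys =
      concat (map2 (\<lambda>h a. replicate h z @ [a]) ((Hs(c := hs)) q) (colour_class q xs))" by auto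
    have "replicate g z = replicate (g - h) z @ replicate h z"
      using h(2) by (simp add: replicate_add[symmetric])
    then show ?thesis using ys x gs h True
      by (intro exI[of _ "replicate (g - h) (z, r) @ replicate h (z, c) @ (a, c) # ys"]) auto
  next
    case False
    have "\<exists>ys. map fst ys = weave z (map fst xs) gs' \<and> (\<forall>q<r. colour_class q ys =
      concat (map2 (\<lambda>h a. replicate h z @ [a]) (Hs q) (colour_class q xs)))"
    proof (rule Cons.IH[OF gs(2)])
      fix q assume "q < r"
      then show "list_all2 (\<le>) (Hs q) (colour_class q (zip gs' (map snd xs)))"
        using Cons.prems(2)[of q] x gs False by auto
    qed
    then obtain ys where ys: "map fst ys = weave z (map fst xs) gs'" "\<And>q. q < r \<Longrightarrow> colour_class q ys =
      concat (map2 (\<lambda>h a. replicate h z @ [a]) (Hs q) (colour_class q xs))" by auto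
    then show ?thesis using x gs False
      by (intro exI[of _ "replicate g (z, r) @ (a, r) # ys"]) auto
  qed
qed

text \<open>\<open>P t\<close> is the set of positions of the \<open>t\<close>-th letters of an optimal choice of twins in \<open>v\<close>.\<close>

lemma max_twins_weave:
  assumes r: "r > 0"
  shows "\<exists>P. (\<forall>t<max_twins r v. P t \<subseteq> {..<length v} \<and> card (P t) = r) \<and>
    (\<forall>gs J. length gs = Suc (length v) \<longrightarrow>
       (\<Sum>t<max_twins r v. card {j \<in> {..J}. \<forall>p\<in>P t. j \<le> gs ! p}) \<le> max_twins r (weave z v gs))"
proof -
  obtain xs u where xs: "map fst xs = v" "\<And>q. q < r \<Longrightarrow> colour_class q xs = u"
    "length u = max_twins r v" using max_twins_colouring[OF r] by blast
  define T where "T = max_twins r v"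
  have lenxs: "length xs = length v" using xs by auto
  define ps where "ps q = filter (\<lambda>i. map snd xs ! i = q) [0..<length v]" for q
  have len_ps: "length (ps q) = T" if "q < r" for q
  proof -
    have "xs = zip v (map snd xs)" using xs by (metis zip_map_fst_snd)
    then have "colour_class q xs = map ((!) v) (ps q)"
      by (metis colour_class_zip ps_def length_map lenxs order_refl)
    then show ?thesis using xs(2)[OF that] xs(3) by (metis T_def length_map)
  qed
  define P where "P t = (\<lambda>q. ps q ! t) ` {..<r}" for t
  have ps: "ps q ! t < length v" "snd (xs ! (ps q ! t)) = q" if "q < r" "t < T" for q t
  proof -
    have "ps q ! t \<in> set (ps q)" using that len_ps by auto
    then show "ps q ! t < length v" "snd (xs ! (ps q ! t)) = q" by (auto simp: ps_def lenxs)
  qed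
  show ?thesis
  proof (rule exI[of _ P], intro conjI allI impI)
    fix t assume t: "t < max_twins r v"
    have "inj_on (\<lambda>q. ps q ! t) {..<r}"
      using ps(2) t by (intro inj_onI) (metis T_def lessThan_iff)
    then have "P t \<subseteq> {..<length v} \<and> card (P t) = r"
      using ps(1) t by (auto simp: P_def card_image T_def)
    then show "P t \<subseteq> {..<length v}" "card (P t) = r" by auto
  next
    fix gs :: "nat list" and J assume gs: "length gs = Suc (length v)"
    \<comment> \<open>All twins must insert the same number of copies, hence the minimum of the
      \<open>r\<close> gaps.\<close>
    define H where "H = map (\<lambda>t. Min ((!) gs ` P t)) [0..<T]"
    have "list_all2 (\<le>) H (colour_class q (zip gs (map snd xs)))" if q: "q < r" for q
    proof -
      have "colour_class q (zip gs (map snd xs)) = map ((!) gs) (ps q)"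
        using gs lenxs by (subst colour_class_zip) (auto simp: ps_def)
      then show ?thesis
        using len_ps[OF q] q by (auto simp: list_all2_conv_all_nth H_def P_def intro!: Min_le)
    qed
    then obtain ys where ys: "map fst ys = weave z v gs" "\<And>q. q < r \<Longrightarrow> colour_class q ys =
      concat (map2 (\<lambda>h a. replicate h z @ [a]) H u)"
      using colouring_weave[of gs xs r "\<lambda>_. H" z] xs lenxs gs by auto
    have lenH: "length H = length u" by (simp add: H_def T_def xs)
    \<comment> \<open>The index \<open>j = 0\<close> accounts for the letter of \<open>v\<close>
      itself, each \<open>j > 0\<close> for one inserted \<open>z\<close>.\<close>
    have "(\<Sum>t<T. card {j \<in> {..J}. \<forall>p\<in>P t. j \<le> gs ! p}) \<le> (\<Sum>t<T. Suc (Min ((!) gs ` P t)))"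
    proof (intro sum_mono)
      fix t assume "t \<in> {..<T}"
      have "finite (P t)" "P t \<noteq> {}" using r by (auto simp: P_def)
      then have "{j \<in> {..J}. \<forall>p\<in>P t. j \<le> gs ! p} \<subseteq> {..Min ((!) gs ` P t)}"
        by (auto intro!: Min.boundedI)
      from card_mono[OF finite_atMost this]
      show "card {j \<in> {..J}. \<forall>p\<in>P t. j \<le> gs ! p} \<le> Suc (Min ((!) gs ` P t))"
        unfolding card_atMost .
    qed
    also have "\<dots> = sum_list (map Suc H)"
      by (simp add: H_def o_def interv_sum_list_conv_sum_set_nat atLeast0LessThan)
    also have "\<dots> = length (concat (map2 (\<lambda>h a. replicate h z @ [a]) H u))"
      using lenH by (induction H u rule: list_induct2) auto
    also have "\<dots> \<le> max_twins r (weave z v gs)"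
      by (rule length_colour_class_le_max_twins[OF r ys])
    finally show "(\<Sum>t<max_twins r v. card {j \<in> {..J}. \<forall>p\<in>P t. j \<le> gs ! p}) \<le> max_twins r (weave z v gs)"
      unfolding T_def .
  qed
qed

section \<open>Summation over all insertions\<close>

lemma card_gap_lists_large_gaps:
  assumes "P \<subseteq> {..<l}"
  shows "card (gap_lists l s) \<le> card {gs \<in> gap_lists l (s + j * card P). \<forall>p\<in>P. j \<le> gs ! p}"
proof (rule card_inj_on_le)
  \<comment> \<open>Enlarging every gap in \<open>P\<close> by \<open>j\<close> is injective and
    adds \<open>j * card P\<close> to the total.\<close>
  let ?f = "\<lambda>gs. map (\<lambda>i. gs ! i + (if i \<in> P then j else 0)) [0..<l]"
  show "inj_on ?f (gap_lists l s)"
    by (rule inj_onI) (auto simp: gap_lists_def intro!: nth_equalityI)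
  show "?f ` gap_lists l s \<subseteq> {gs \<in> gap_lists l (s + j * card P). \<forall>p\<in>P. j \<le> gs ! p}"
  proof (clarify, intro conjI ballI)
    fix gs assume "gs \<in> gap_lists l s"
    then have gs: "length gs = l" "(\<Sum>i<l. gs ! i) = s"
      by (auto simp: gap_lists_def sum_list_sum_nth atLeast0LessThan)
    have "{..<l} \<inter> P = P" using assms by auto
    then have "sum_list (?f gs) = s + j * card P"
      using gs by (simp add: interv_sum_list_conv_sum_set_nat atLeast0LessThan sum.distrib sum.If_cases)
    then show "?f gs \<in> gap_lists l (s + j * card P)" by (simp add: gap_lists_def)
    show "j \<le> ?f gs ! p" if "p \<in> P" for p using that assms by auto
  qed
qed simp

text \<open>Exchange the sums: for each \<open>t\<close> and \<open>j\<close>, at least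
  \<open>(n - j * r) choose m\<close> gap lists have all \<open>r\<close> gaps in \<open>P t\<close>
  of size at least \<open>j\<close>. Of \<open>v\<close>, only its length and
  \<open>max_twins r v\<close> enter.\<close>

lemma sum_max_twins_weave:
  assumes r: "r > 0" and v: "length v = m" and n: "m \<le> n" "J * r \<le> n"
  shows "max_twins r v * (\<Sum>j\<le>J. (n - j * r) choose m)
    \<le> (\<Sum>gs\<in>gap_lists (Suc m) (n - m). max_twins r (weave z v gs))"
proof -
  obtain P where P: "\<forall>t<max_twins r v. P t \<subseteq> {..<length v} \<and> card (P t) = r"
    and weave: "\<forall>gs J. length gs = Suc (length v) \<longrightarrow>
       (\<Sum>t<max_twins r v. card {j \<in> {..J}. \<forall>p\<in>P t. j \<le> gs ! p}) \<le> max_twins r (weave z v gs)"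
    using max_twins_weave[OF r, of v z] by blast
  have bound: "(n - j * r) choose m \<le> card {gs \<in> gap_lists (Suc m) (n - m). \<forall>p\<in>P t. j \<le> gs ! p}"
    if t: "t < max_twins r v" and j: "j \<le> J" for j t
  proof (cases "m + j * r \<le> n")
    case True
    have "P t \<subseteq> {..<m}" and Pt_card: "card (P t) = r" using P t v by auto
    then have Pt: "P t \<subseteq> {..<Suc m}" by auto
    have "(n - j * r) choose m = card (gap_lists (Suc m) (n - m - j * r))"
      using True by (simp add: card_gap_lists)
    also have "\<dots> \<le> card {gs \<in> gap_lists (Suc m) (n - m - j * r + j * card (P t)). \<forall>p\<in>P t. j \<le> gs ! p}"
      using Pt by (rule card_gap_lists_large_gaps)
    finally show ?thesis using True Pt_card by simp
  next
    case False
    \<comment> \<open>So \<open>n - j * r\<close> is not truncated; it lies below \<open>m\<close>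
      and the binomial coefficient vanishes.\<close>
    moreover have "j * r \<le> n" using j n(2) by (meson le_trans mult_le_mono1)
    ultimately have "n - j * r < m" by linarith
    then show ?thesis by (simp add: binomial_eq_0)
  qed
  have "max_twins r v * (\<Sum>j\<le>J. (n - j * r) choose m)
      = (\<Sum>t<max_twins r v. \<Sum>j\<le>J. (n - j * r) choose m)" by simp
  also have "\<dots> \<le> (\<Sum>t<max_twins r v. \<Sum>j\<le>J. card {gs \<in> gap_lists (Suc m) (n - m). \<forall>p\<in>P t. j \<le> gs ! p})"
    by (intro sum_mono bound) auto
  also have "\<dots> = (\<Sum>t<max_twins r v. \<Sum>j\<le>J. \<Sum>gs\<in>gap_lists (Suc m) (n - m). of_bool (\<forall>p\<in>P t. j \<le> gs ! p))"
    by (simp add: sum_of_bool_eq Int_def conj_commute)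
  also have "\<dots> = (\<Sum>t<max_twins r v. \<Sum>gs\<in>gap_lists (Suc m) (n - m). \<Sum>j\<le>J. of_bool (\<forall>p\<in>P t. j \<le> gs ! p))"
    by (intro sum.cong refl sum.swap)
  also have "\<dots> = (\<Sum>gs\<in>gap_lists (Suc m) (n - m). \<Sum>t<max_twins r v. \<Sum>j\<le>J. of_bool (\<forall>p\<in>P t. j \<le> gs ! p))"
    by (rule sum.swap)
  also have "\<dots> = (\<Sum>gs\<in>gap_lists (Suc m) (n - m). \<Sum>t<max_twins r v. card {j \<in> {..J}. \<forall>p\<in>P t. j \<le> gs ! p})"
    by (simp add: sum_of_bool_eq Int_def conj_commute)
  also have "\<dots> \<le> (\<Sum>gs\<in>gap_lists (Suc m) (n - m). max_twins r (weave z v gs))"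
    using v weave by (intro sum_mono) (simp add: gap_lists_def)
  finally show ?thesis .
qed

text \<open>Deleting \<open>z\<close> recovers \<open>v\<close>, and the runs of \<open>z\<close>
  then determine \<open>gs\<close>, so distinct data give distinct words; the values of
  \<open>T\<close> are nonnegative.\<close>

lemma sum_words_insert_ge:
  fixes T :: "'a list \<Rightarrow> nat"
  assumes A: "finite A" "z \<notin> A"
  shows "(\<Sum>m\<le>n. \<Sum>v\<in>words A m. \<Sum>gs\<in>gap_lists (Suc m) (n - m). T (weave z v gs))
    \<le> (\<Sum>w\<in>words (insert z A) n. T w)"
proof -
  define X where "X = (SIGMA m:{..n}. SIGMA v:words A m. gap_lists (Suc m) (n - m))"
  define F where "F = (\<lambda>(m :: nat, v, gs). weave z v gs)"
  have inj: "inj_on F X"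
  proof (rule inj_onI)
    fix x y assume xy: "x \<in> X" "y \<in> X" "F x = F y"
    obtain m v gs m' v' gs' where [simp]: "x = (m, v, gs)" "y = (m', v', gs')"
      by (metis prod_cases3)
    have z: "z \<notin> set v" "z \<notin> set v'" using xy A by (auto simp: X_def words_def)
    have [simp]: "v' = v" using xy(3) filter_weave[OF z(1)] filter_weave[OF z(2)] by (metis F_def case_prod_conv \<open>x = _\<close> \<open>y = _\<close>)
    then have [simp]: "m' = m" using xy by (auto simp: X_def words_def)
    have "gs = gs'"
      using xy z by (intro weave_eq_imp_gaps_eq[of z v]) (auto simp: X_def F_def words_def gap_lists_def)
    then show "x = y" by simp
  qed
  have sub: "F ` X \<subseteq> words (insert z A) n"
  proof
    fix w assume "w \<in> F ` X"
    then obtain m v gs where *: "m \<le> n" "v \<in> words A m" "gs \<in> gap_lists (Suc m) (n - m)" "w = weave z v gs"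
      by (auto simp: X_def F_def)
    then show "w \<in> words (insert z A) n"
      using set_weave[of z v gs] length_weave[of gs v z] by (auto simp: words_def gap_lists_def)
  qed
  have "(\<Sum>m\<le>n. \<Sum>v\<in>words A m. \<Sum>gs\<in>gap_lists (Suc m) (n - m). T (weave z v gs)) = (\<Sum>x\<in>X. T (F x))"
    using A by (simp add: X_def F_def sum.Sigma case_prod_unfold)
  also have "\<dots> = (\<Sum>w\<in>F ` X. T w)"
    using inj by (simp add: sum.reindex)
  also have "\<dots> \<le> (\<Sum>w\<in>words (insert z A) n. T w)"
    using sub A by (intro sum_mono2) auto
  finally show ?thesis .
qed

text \<open>Up to the factor \<open>(k + 1) ^ i\<close>, this is the expectation of
  \<open>c * m - C\<close> for a binomial \<open>m\<close> with \<open>i\<close> trials and success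
  probability \<open>k / (k + 1)\<close>.\<close>

lemma sum_binomial_linear:
  fixes k c C :: real
  assumes "i \<le> n" "k > 0"
  shows "(\<Sum>m\<le>n. ((c * real m - C) * k ^ m) * real (i choose m))
    = c * real i * (k / (k + 1)) * (k + 1) ^ i - C * (k + 1) ^ i"
proof -
  have "(\<Sum>m\<le>n. ((c * real m - C) * k ^ m) * real (i choose m))
      = (\<Sum>m\<le>i. ((c * real m - C) * k ^ m) * real (i choose m))"
    using assms by (intro sum.mono_neutral_right) auto
  \<comment> \<open>The powers of \<open>1\<close> match the two-variable binomial theorem and its
    derivative.\<close>
  also have "\<dots> = (\<Sum>m\<le>i. c * k * (real m * real (i choose m) * k ^ (m - 1) * 1 ^ (i - m))
      - C * (real (i choose m) * k ^ m * 1 ^ (i - m)))"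
  proof (intro sum.cong refl)
    fix m
    show "((c * real m - C) * k ^ m) * real (i choose m) =
      c * k * (real m * real (i choose m) * k ^ (m - 1) * 1 ^ (i - m)) - C * (real (i choose m) * k ^ m * 1 ^ (i - m))"
      by (cases m) (auto simp: algebra_simps)
  qed
  also have "\<dots> = c * k * (real i * (k + 1) ^ (i - 1)) - C * (k + 1) ^ i"
    unfolding sum_subtractf sum_distrib_left[symmetric] binomial_deriv1 binomial_ring ..
  also have "real i * (k + 1) ^ (i - 1) = real i * (k + 1) ^ i / (k + 1)"
    using assms by (cases i) auto
  finally show ?thesis by simp
qed

text \<open>Sum the insertion bound over all \<open>v\<close>, replace the sums of
  \<open>max_twins r v\<close> by the linear bound, and evaluate over \<open>m\<close> by the
  binomial sum with \<open>i = n - j * r\<close>. Normalisation leaves the weight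
  \<open>(k + 1) ^ (- j * r)\<close>.\<close>

lemma mean_max_twins_insert_ge:
  assumes r: "r > 0" and A: "finite A" "A \<noteq> {}" "z \<notin> A"
    and lin: "\<And>m. c * real m - C \<le> mean A m (\<lambda>w. real (max_twins r w))"
    and n: "J * r \<le> n"
  defines "k \<equiv> real (card A)"
  shows "(\<Sum>j\<le>J. (c * (k / (k + 1)) * real (n - j * r) - C) / (k + 1) ^ (j * r))
    \<le> mean (insert z A) n (\<lambda>w. real (max_twins r w))"
proof -
  have k: "k > 0" using A by (simp add: k_def card_gt_0_iff)
  have lin': "(c * real m - C) * k ^ m \<le> (\<Sum>v\<in>words A m. real (max_twins r v))" for m
    using lin[of m] k by (simp add: mean_def k_def le_divide_eq)
  have "(\<Sum>j\<le>J. (c * (k / (k + 1)) * real (n - j * r) - C) * (k + 1) ^ (n - j * r))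
      = (\<Sum>j\<le>J. \<Sum>m\<le>n. ((c * real m - C) * k ^ m) * real ((n - j * r) choose m))"
    using k by (intro sum.cong refl) (subst sum_binomial_linear, auto simp: algebra_simps)
  also have "\<dots> = (\<Sum>m\<le>n. ((c * real m - C) * k ^ m) * (\<Sum>j\<le>J. real ((n - j * r) choose m)))"
    by (subst sum.swap) (simp add: sum_distrib_left)
  also have "\<dots> \<le> (\<Sum>m\<le>n. (\<Sum>v\<in>words A m. real (max_twins r v)) * (\<Sum>j\<le>J. real ((n - j * r) choose m)))"
    by (intro sum_mono mult_right_mono lin' sum_nonneg) auto
  also have "\<dots> = real (\<Sum>m\<le>n. \<Sum>v\<in>words A m. max_twins r v * (\<Sum>j\<le>J. (n - j * r) choose m))"
    by (simp add: sum_distrib_right)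
  also have "\<dots> \<le> real (\<Sum>m\<le>n. \<Sum>v\<in>words A m. \<Sum>gs\<in>gap_lists (Suc m) (n - m). max_twins r (weave z v gs))"
    unfolding of_nat_le_iff using n
    by (intro sum_mono sum_max_twins_weave[OF r]) (auto simp: words_def)
  also have "\<dots> \<le> real (\<Sum>w\<in>words (insert z A) n. max_twins r w)"
    unfolding of_nat_le_iff by (rule sum_words_insert_ge[OF A(1,3)])
  finally have "(\<Sum>j\<le>J. (c * (k / (k + 1)) * real (n - j * r) - C) * (k + 1) ^ (n - j * r)) / (k + 1) ^ n
      \<le> mean (insert z A) n (\<lambda>w. real (max_twins r w))"
    using A k unfolding mean_def by (simp add: k_def divide_right_mono add.commute)
  moreover have "(\<Sum>j\<le>J. (c * (k / (k + 1)) * real (n - j * r) - C) * (k + 1) ^ (n - j * r)) / (k + 1) ^ n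
      = (\<Sum>j\<le>J. (c * (k / (k + 1)) * real (n - j * r) - C) / (k + 1) ^ (j * r))"
    unfolding sum_divide_distrib
  proof (intro sum.cong refl)
    fix j assume "j \<in> {..J}"
    then have "j * r \<le> n" using n by (meson atMost_iff le_trans mult_le_mono1)
    then have "(k + 1) ^ n = (k + 1) ^ (n - j * r) * (k + 1) ^ (j * r)"
      by (simp add: power_add[symmetric])
    then show "(c * (k / (k + 1)) * real (n - j * r) - C) * (k + 1) ^ (n - j * r) / (k + 1) ^ n
      = (c * (k / (k + 1)) * real (n - j * r) - C) / (k + 1) ^ (j * r)"
      using k by simp
  qed
  ultimately show ?thesis by simp
qed

text \<open>Per letter, the preceding bound tends to a partial geometric sum in
  \<open>\<rho>\<close> as \<open>n\<close> grows; large \<open>J\<close> brings it near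
  \<open>1 / (1 - \<rho>)\<close>.\<close>

lemma mean_max_twins_insert:
  assumes r: "r > 0" and A: "finite A" "A \<noteq> {}" "z \<notin> A" and c0: "c0 > 0"
    and IH: "\<And>c. c < c0 \<Longrightarrow> \<exists>n>0. c * real n \<le> mean A n (\<lambda>w. real (max_twins r w))"
  defines "k \<equiv> real (card A)"
  assumes c': "c' < c0 * (k / (k + 1)) / (1 - 1 / (k + 1) ^ r)"
  shows "\<exists>n>0. c' * real n \<le> mean (insert z A) n (\<lambda>w. real (max_twins r w))"
proof -
  have k: "k > 0" using A by (simp add: k_def card_gt_0_iff)
  define \<rho> where "\<rho> = 1 / (k + 1) ^ r"
  have \<rho>: "0 < \<rho>" "\<rho> < 1" using k r by (auto simp: \<rho>_def one_less_power)
  define \<alpha> where "\<alpha> = (k / (k + 1)) / (1 - \<rho>)"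
  have \<alpha>: "\<alpha> > 0" using k \<rho> by (simp add: \<alpha>_def)
  have c'_less: "c' < c0 * \<alpha>" using c' by (simp add: \<alpha>_def \<rho>_def)
  \<comment> \<open>The maximum makes \<open>c\<close> positive, as the linear bound for
    superadditive means requires \<open>c \<ge> 0\<close>.\<close>
  have "max 0 (c' / \<alpha>) < c0"
    using c0 c'_less \<alpha> by (simp add: pos_divide_less_eq)
  then obtain c where c: "max 0 (c' / \<alpha>) < c" "c < c0" using dense by blast
  then have c_pos: "c > 0" and "c' < c * \<alpha>"
    using \<alpha> by (auto simp: pos_divide_less_eq)
  have "(\<lambda>J. c * (k / (k + 1)) * (\<Sum>j\<le>J. \<rho> ^ j)) \<longlonglongrightarrow> c * (k / (k + 1)) * (1 / (1 - \<rho>))"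
    using geometric_sums[of \<rho>] \<rho> by (intro tendsto_intros) (simp add: sums_def_le)
  then have "\<forall>\<^sub>F J in sequentially. c' < c * (k / (k + 1)) * (\<Sum>j\<le>J. \<rho> ^ j)"
    by (rule order_tendstoD) (use \<open>c' < c * \<alpha>\<close> in \<open>simp add: \<alpha>_def\<close>)
  then obtain J where J: "c' < c * (k / (k + 1)) * (\<Sum>j\<le>J. \<rho> ^ j)"
    by (auto dest: eventually_happens)
  define c'' where "c'' = c * (k / (k + 1)) * (\<Sum>j\<le>J. \<rho> ^ j)"
  obtain m where m: "m > 0" "c * real m \<le> mean A m (\<lambda>w. real (max_twins r w))"
    using IH[OF c(2)] by blast
  define C where "C = c * real m"
  have lin: "c * real n - C \<le> mean A n (\<lambda>w. real (max_twins r w))" for n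
    unfolding C_def using A m c_pos max_twins_append[OF r]
    by (intro mean_superadditive_linear_bound) (auto simp flip: of_nat_add)
  \<comment> \<open>Collects every loss that does not depend on \<open>n\<close>.\<close>
  define D where "D = (\<Sum>j\<le>J. (c * (k / (k + 1)) * real (j * r) + C) * \<rho> ^ j)"
  \<comment> \<open>The absolute value gives \<open>J * r \<le> n\<close> whatever the sign of the
    quotient.\<close>
  obtain n where n: "real n > D / (c'' - c') + real (J * r) + \<bar>D / (c'' - c')\<bar> + 1"
    using reals_Archimedean2 by blast
  have n': "J * r \<le> n" "n > 0" "D / (c'' - c') \<le> real n"
    using n by linarith+
  have "c' < c''" unfolding c''_def by (rule J)
  then have D: "c' * real n \<le> c'' * real n - D"
    using n'(3) by (simp add: pos_divide_le_eq algebra_simps)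
  have "c'' * real n - D = (\<Sum>j\<le>J. (c * (k / (k + 1)) * real n) * \<rho> ^ j - (c * (k / (k + 1)) * real (j * r) + C) * \<rho> ^ j)"
    by (simp add: c''_def D_def sum_subtractf sum_distrib_left sum_distrib_right sum_divide_distrib mult_ac)
  also have "\<dots> = (\<Sum>j\<le>J. (c * (k / (k + 1)) * real (n - j * r) - C) / (k + 1) ^ (j * r))"
  proof (intro sum.cong refl)
    fix j assume "j \<in> {..J}"
    then have "j * r \<le> n" using n' by (meson atMost_iff le_trans mult_le_mono1)
    moreover have "\<rho> ^ j = 1 / (k + 1) ^ (j * r)"
      by (simp add: \<rho>_def power_divide power_mult[symmetric] mult.commute)
    ultimately show "(c * (k / (k + 1)) * real n) * \<rho> ^ j - (c * (k / (k + 1)) * real (j * r) + C) * \<rho> ^ j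
        = (c * (k / (k + 1)) * real (n - j * r) - C) / (k + 1) ^ (j * r)"
      by (simp add: of_nat_diff algebra_simps diff_divide_distrib add_divide_distrib)
  qed
  also have "\<dots> \<le> mean (insert z A) n (\<lambda>w. real (max_twins r w))"
    unfolding k_def by (rule mean_max_twins_insert_ge[OF r A lin n'(1)])
  finally show ?thesis using D n'(2) by (intro exI[of _ n]) auto
qed

section \<open>The constant and the induction on the alphabet\<close>

lemma Pi_const_Suc:
  assumes "r > 0" "k \<ge> r"
  shows "Pi_const r (Suc k) / real (Suc k)
    = Pi_const r k / real k * (real k / (real k + 1)) / (1 - 1 / (real k + 1) ^ r)"
proof -
  have "1 < (real k + 1) ^ r" using assms by (intro one_less_power) auto
  moreover have "Pi_const r (Suc k) = Pi_const r k * ((real k + 1) ^ r / ((real k + 1) ^ r - 1))"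
    unfolding Pi_const_def using assms by (simp add: add.commute)
  ultimately show ?thesis using assms by (simp add: field_simps)
qed

lemma Pi_const_pos:
  assumes "r > 0"
  shows "Pi_const r k > 0"
  unfolding Pi_const_def using assms
  by (intro prod_pos divide_pos_pos) (auto intro!: one_less_power)

text \<open>At \<open>k = r\<close> the product is empty and the bound is \<open>1 / r\<close>; each
  further letter contributes one factor through \<open>Pi_const_Suc\<close>.\<close>

lemma mean_max_twins:
  assumes r: "r > 0" and "k \<ge> r" and "finite A" "card A = k" and "c < Pi_const r k / real k"
  shows "\<exists>n>0. c * real n \<le> mean A n (\<lambda>w. real (max_twins r w))"
  using assms(2-)
proof (induction k arbitrary: A c rule: dec_induct)
  case base
  then show ?case by (intro mean_max_twins_card_eq[OF r]) (auto simp: Pi_const_def)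
next
  case (step k)
  obtain z B where B: "A = insert z B" "z \<notin> B" "card B = k" "finite B"
    using step.prems by (metis card_Suc_eq finite_insert)
  show ?case
    unfolding B(1)
  proof (rule mean_max_twins_insert[OF r B(4) _ B(2)])
    show "B \<noteq> {}" using B r step.hyps by auto
    show "Pi_const r k / real k > 0" using Pi_const_pos[OF r] r step.hyps by simp
    show "\<exists>n>0. c * real n \<le> mean B n (\<lambda>w. real (max_twins r w))" if "c < Pi_const r k / real k" for c
      using step.IH B that by blast
    show "c < Pi_const r k / real k * (real (card B) / (real (card B) + 1)) / (1 - 1 / (real (card B) + 1) ^ r)"
      using step.prems(3) Pi_const_Suc[OF r step.hyps(1)] B by simp
  qed
qed

subsection \<open>The random word\<close>

text \<open>Turns convergence for each fixed \<open>\<epsilon>\<close> into one error sequence: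
  \<open>1 / (i + 1)\<close> is used only once \<open>n\<close> exceeds a threshold
  \<open>N i\<close>, with \<open>i\<close> as large as possible.\<close>

lemma diagonal_error_term:
  fixes p :: "real \<Rightarrow> nat \<Rightarrow> real"
  assumes lim: "\<And>\<epsilon>. \<epsilon> > 0 \<Longrightarrow> p \<epsilon> \<longlonglongrightarrow> 0" and nonneg: "\<And>\<epsilon> n. 0 \<le> p \<epsilon> n"
  shows "\<exists>\<epsilon>. \<epsilon> \<longlonglongrightarrow> 0 \<and> (\<lambda>n. p (\<epsilon> n) n) \<longlonglongrightarrow> 0"
proof -
  have "\<exists>N. \<forall>n\<ge>N. p (1 / real (Suc i)) n < 1 / real (Suc i)" for i
    using order_tendstoD(2)[OF lim, of "1 / real (Suc i)" "1 / real (Suc i)"]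
    by (simp add: eventually_sequentially)
  then obtain N where N: "\<And>i n. n \<ge> N i \<Longrightarrow> p (1 / real (Suc i)) n < 1 / real (Suc i)"
    by metis
  \<comment> \<open>The bound \<open>i \<le> n\<close> keeps the set finite; from \<open>N 0\<close>
    on it contains \<open>0\<close>, so its maximum is meaningful.\<close>
  define S where "S n = {i. i \<le> n \<and> N i \<le> n}" for n
  define I where "I n = Max (S n)" for n
  have fin: "finite (S n)" for n unfolding S_def by auto
  have I_ge: "i \<le> I n" if "i \<le> n" "N i \<le> n" for i n
    unfolding I_def using that fin by (intro Max_ge) (auto simp: S_def)
  have I_in: "N (I n) \<le> n" if "N 0 \<le> n" for n
  proof -
    have "I n \<in> S n" unfolding I_def using that fin by (intro Max_in) (auto simp: S_def)
    then show ?thesis by (simp add: S_def)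
  qed
  have "filterlim I at_top sequentially"
    unfolding filterlim_at_top
  proof
    fix i
    show "\<forall>\<^sub>F n in sequentially. i \<le> I n"
      using eventually_ge_at_top[of "max i (N i)"] by eventually_elim (auto intro: I_ge)
  qed
  then have \<epsilon>: "(\<lambda>n. 1 / real (Suc (I n))) \<longlonglongrightarrow> 0"
    using filterlim_compose[OF LIMSEQ_inverse_real_of_nat] by (simp add: inverse_eq_divide)
  moreover have "(\<lambda>n. p (1 / real (Suc (I n))) n) \<longlonglongrightarrow> 0"
  proof (rule tendsto_sandwich[OF _ _ tendsto_const \<epsilon>])
    show "\<forall>\<^sub>F n in sequentially. 0 \<le> p (1 / real (Suc (I n))) n"
      by (intro always_eventually allI nonneg)
    show "\<forall>\<^sub>F n in sequentially. p (1 / real (Suc (I n))) n \<le> 1 / real (Suc (I n))"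
      using eventually_ge_at_top[of "N 0"] by eventually_elim (rule less_imp_le[OF N[OF I_in]])
  qed
  ultimately show ?thesis by blast
qed

lemma prob_random_word:
  assumes "finite A" "A \<noteq> {}"
  shows "measure_pmf.prob (random_word A n) {w. P w} = mean A n (\<lambda>w. of_bool (P w))"
proof -
  have "words A n \<noteq> {}" using card_words[of A n] assms by force
  then have "measure_pmf.prob (pmf_of_set (words A n)) {w. P w} = real (card (words A n \<inter> {w. P w})) / real (card (words A n))"
    using assms by (intro measure_pmf_of_set) auto
  then show ?thesis
    using assms by (simp add: random_word_def words_def[symmetric] mean_eq_card card_words Int_def)
qed

theorem theorem1p3:
  fixes k r :: nat and A :: "'a set"
  assumes "k > r" and "r \<ge> 3"
    and "finite A" and "card A = k"
  shows "\<exists>f :: nat \<Rightarrow> real. f \<in> o(\<lambda>n. real n) \<and>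
    (\<lambda>n. measure_pmf.prob (random_word A n)
           {w. real (max_twins r w) \<ge> Pi_const r k * (real n / real k) - f n})
      \<longlonglongrightarrow> 1"
proof -
  have r: "r > 0" and A: "A \<noteq> {}" using assms by auto
  define c where "c = Pi_const r k / real k"
  define p where "p \<epsilon> n = mean A n (\<lambda>w. of_bool (real (max_twins r w) < (c - \<epsilon>) * real n))" for \<epsilon> n
  have "p \<epsilon> \<longlonglongrightarrow> 0" if \<epsilon>: "\<epsilon> > 0" for \<epsilon>
  proof -
    \<comment> \<open>Half of \<open>\<epsilon>\<close> pays for the mean lying below
      \<open>c\<close>, the other half for the deviation from the mean.\<close>
    obtain m where m: "m > 0" "(c - \<epsilon> / 2) * real m \<le> mean A m (\<lambda>w. real (max_twins r w))"
      using mean_max_twins[OF r less_imp_le[OF assms(1)] assms(3,4), of "c - \<epsilon> / 2"] \<epsilon> by (auto simp: c_def)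
    have "(\<lambda>n. mean A n (\<lambda>w. of_bool (real (max_twins r w) < (c - \<epsilon> / 2 - \<epsilon> / 2) * real n))) \<longlonglongrightarrow> 0"
      using \<epsilon> m max_twins_append[OF r] max_twins_le_length[OF r] assms(3) A
      by (intro prob_superadditive_less_tendsto_0[where m = m]) (auto simp flip: of_nat_add)
    then show ?thesis by (simp add: p_def[abs_def])
  qed
  moreover have "0 \<le> p \<epsilon> n" for \<epsilon> n unfolding p_def by (intro mean_nonneg) auto
  ultimately obtain \<epsilon> where \<epsilon>: "\<epsilon> \<longlonglongrightarrow> 0" "(\<lambda>n. p (\<epsilon> n) n) \<longlonglongrightarrow> 0"
    using diagonal_error_term by blast
  have "(\<lambda>n. \<epsilon> n * real n) \<in> o(\<lambda>n. real n)"
  proof (rule smalloI_tendsto)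
    have "\<forall>\<^sub>F n in sequentially. \<epsilon> n = \<epsilon> n * real n / real n"
      using eventually_gt_at_top[of 0] by eventually_elim auto
    then show "(\<lambda>n. \<epsilon> n * real n / real n) \<longlonglongrightarrow> 0"
      using \<epsilon>(1) by (rule Lim_transform_eventually[rotated])
    show "\<forall>\<^sub>F n in sequentially. real n \<noteq> 0"
      using eventually_gt_at_top[of 0] by eventually_elim auto
  qed
  moreover have "measure_pmf.prob (random_word A n)
      {w. real (max_twins r w) \<ge> Pi_const r k * (real n / real k) - \<epsilon> n * real n} = 1 - p (\<epsilon> n) n" for n
  proof -
    have "mean A n (\<lambda>w. of_bool (real (max_twins r w) \<ge> (c - \<epsilon> n) * real n)) + p (\<epsilon> n) n = mean A n (\<lambda>w. 1)"
      unfolding p_def mean_add[symmetric] by (rule arg_cong[where f = "mean A n"]) auto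
    then show ?thesis
      using assms(3) A by (simp add: prob_random_word mean_const c_def algebra_simps)
  qed
  moreover have "(\<lambda>n. 1 - p (\<epsilon> n) n) \<longlonglongrightarrow> 1 - 0"
    using \<epsilon>(2) by (intro tendsto_intros)
  ultimately show ?thesis
    by (intro exI[of _ "\<lambda>n. \<epsilon> n * real n"]) simp
qed

end
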